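(* Let $f\colon[-1,1)\to\mathbb{R}$ be absolutely monotonic. Then for all complex numbers $a_0,a_1,a_2,a_3$ of absolute value $1$, $$E_f(C_{D_4})\le E_f\big(D(a_0,a_1,a_2,a_3)\big).$$ Moreover, unless $f$ is a polynomial of degree at most $5$, $C_{D_4}$ is the unique minimizer within the family up to orthogonal transformations: if $f$ is not a polynomial of degree at most $5$ and equality holds, then $D(a_0,a_1,a_2,a_3)$ is the image of $C_{D_4}$ under an orthogonal transformation of $\mathbb{R}^4$.
   Context: Identify $\mathbb{R}^4$ with $\mathbb{C}^2$, with inner product $\langle(z_1,z_2),(\zeta_1,\zeta_2)\rangle=\operatorname{Re}(z_1\overline{\zeta_1}+z_2\overline{\zeta_2})$, and let $S^3$ be the unit sphere. For a function $f\colon[-1,1)\to\mathbb{R}$ and a finite set $C\subset S^3$, the energy is $$E_f(C)=\sum_{c,c'\in C,\ c\neq c'}f\big(\langle c,c'\rangle\big),$$ the sum being over ordered pairs of distinct points. The function $f$ is absolutely monotonic if it is smooth and $f$ and all its derivatives are nonnegative on $[-1,1)$. Let $\mu_6\subset\mathbb{C}^*$ be the group of sixth roots of unity, $r=e^{2\pi i/3}$, $u=\sqrt{1/3}$, $t=\sqrt{2/3}$, and define \begin{align*} H_0&=\{(w,0):w\in\mu_6\},\\ H_1&=\{(uiw,tiw):w\in\mu_6\},\\ H_2&=\{(uiw,rtiw):w\in\mu_6\},\\ H_3&=\{(uiw,\overline{r}tiw):w\in\mu_6\}. \end{align*} For complex numbers $a_0,a_1,a_2,a_3$ of absolute value $1$,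 define $$D(a_0,a_1,a_2,a_3)=a_0H_0\cup a_1H_1\cup a_2H_2\cup a_3H_3,$$ where $a_m H_m=\{(a_mz_1,a_mz_2):(z_1,z_2)\in H_m\}$. In these coordinates $C_{D_4}=D(1,1,1,1)$, which is the set of $24$ normalized roots of the $D_4$ root system, i.e. the vertices of a regular $24$-cell. *)

theory Defs
  imports "HOL-Analysis.Analysis" "HOL-Computational_Algebra.Polynomial"
begin

text \<open>
  We use \<^typ>\<open>complex \<times> complex\<close> with its library inner product as the model of \<open>\<real>\<^sup>4 = \<complex>\<^sup>2\<close>.
\<close>

lemma inner_C2: "inner (z1, z2) (y1, y2) = Re (z1 * cnj y1 + z2 * cnj y2)"
  for z1 z2 y1 y2 :: complex
  by (simp add: inner_complex_def)

text \<open>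
  \<open>g n\<close> is the \<open>n\<close>-th derivative of \<open>f\<close> on \<open>[-1,1)\<close>; at the endpoint \<open>-1\<close> the derivatives are
  one-sided. Values of \<open>f\<close> outside \<open>[-1,1)\<close> are irrelevant.
\<close>

definition absolutely_monotonic :: "(real \<Rightarrow> real) \<Rightarrow> bool" where
  "absolutely_monotonic f \<longleftrightarrow>
     (\<exists>g :: nat \<Rightarrow> real \<Rightarrow> real.
        (\<forall>x\<in>{-1..<1}. g 0 x = f x) \<and>
        (\<forall>n. \<forall>x\<in>{-1..<1}. (g n has_real_derivative g (Suc n) x) (at x within {-1..<1})) \<and>
        (\<forall>n. \<forall>x\<in>{-1..<1}. g n x \<ge> 0))"

definition energy :: "(real \<Rightarrow> real) \<Rightarrow> (complex \<times> complex) set \<Rightarrow> real" where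
  "energy f C = (\<Sum>c\<in>C. \<Sum>c'\<in>C - {c}. f (inner c c'))"

definition poly_degree_le_on :: "real set \<Rightarrow> nat \<Rightarrow> (real \<Rightarrow> real) \<Rightarrow> bool" where
  "poly_degree_le_on S n f \<longleftrightarrow> (\<exists>p :: real poly. degree p \<le> n \<and> (\<forall>x\<in>S. f x = poly p x))"

definition mu6 :: "complex set" where
  "mu6 = {w. w ^ 6 = 1}"

definition r_D4 :: complex where
  "r_D4 = exp (2 * complex_of_real pi * \<i> / 3)"

definition u_D4 :: complex where
  "u_D4 = complex_of_real (sqrt (1/3))"

definition t_D4 :: complex where
  "t_D4 = complex_of_real (sqrt (2/3))"

definition H0 :: "(complex \<times> complex) set" where
  "H0 = (\<lambda>w. (w, 0)) ` mu6"

definition H1 :: "(complex \<times> complex) set" where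
  "H1 = (\<lambda>w. (u_D4 * \<i> * w, t_D4 * \<i> * w)) ` mu6"

definition H2 :: "(complex \<times> complex) set" where
  "H2 = (\<lambda>w. (u_D4 * \<i> * w, r_D4 * t_D4 * \<i> * w)) ` mu6"

definition H3 :: "(complex \<times> complex) set" where
  "H3 = (\<lambda>w. (u_D4 * \<i> * w, cnj r_D4 * t_D4 * \<i> * w)) ` mu6"

definition cscale :: "complex \<Rightarrow> (complex \<times> complex) set \<Rightarrow> (complex \<times> complex) set" where
  "cscale a X = (\<lambda>(z1, z2). (a * z1, a * z2)) ` X"

definition D_config ::
    "complex \<Rightarrow> complex \<Rightarrow> complex \<Rightarrow> complex \<Rightarrow> (complex \<times> complex) set" where
  "D_config a0 a1 a2 a3 = cscale a0 H0 \<union> cscale a1 H1 \<union> cscale a2 H2 \<union> cscale a3 H3"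

definition C_D4 :: "(complex \<times> complex) set" where
  "C_D4 = D_config 1 1 1 1"

end

theory Submission
  imports Defs
begin

text \<open>
  Each hexagon \<open>H\<^sub>m\<close> is an orbit of \<open>\<mu>\<^sub>6\<close>, so the energy of a configuration in the family splits into
  the energies inside the four hexagons, which do not depend on the phases, and one interaction term
  for each ordered pair of different hexagons.  The Hermitian product of the axes of two different
  hexagons is \<open>\<plusminus>\<i>/\<surd>3\<close>, hence for every such pair the interaction is six times
  \<open>S f z = (\<Sum>w\<in>\<mu>\<^sub>6. f (Re (z * w) / \<surd>3))\<close> for some \<open>z\<close> on the unit circle, and \<open>z = \<plusminus>\<i>\<close> when all phases
  are 1 (\<open>energy_D_config\<close>).  It therefore suffices to minimize \<open>S f\<close> over the circle: the point \<open>\<i>\<close> is a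
  minimum, and the minima of all the pair interactions are attained simultaneously by the
  24-cell.

  For \<open>z = \<i>\<close> the arguments of \<open>f\<close> are \<open>0, 1/2, -1/2\<close>, each of them twice.  Let \<open>p\<close> be the polynomial of
  degree at most 5 that has the value and slope of \<open>f\<close> at these three points.  By the error formula
  for Hermite interpolation, \<open>f - p\<close> is the sixth derivative of \<open>f\<close> at some point times a square, so
  \<open>p \<le> f\<close> (\<open>quintic_minorant\<close>).  A regular hexagon is a spherical 5-design on the circle, so \<open>S p\<close> is
  constant (\<open>hexagon_sum_poly\<close>), and \<open>S f z \<ge> S p z = S p \<i> = S f \<i>\<close>.

  If equality holds at a \<open>z\<close> for which some argument is not an interpolation node, the sixth derivative
  has a zero in \<open>(-1,1)\<close>.  Being absolutely monotonic, it then vanishes identically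
  (\<open>absolutely_monotonic_eq_0\<close>), and \<open>f = p\<close>.  Otherwise all the arguments are nodes, which forces
  \<open>z\<^sup>6 = -1\<close>.  Applied to the pairs formed by the first hexagon and another one, this says that the
  phases differ from \<open>a\<^sub>0\<close> by sixth roots of unity only.  These do not change the hexagons as sets, so the
  configuration is \<open>a\<^sub>0 C\<close> with \<open>C\<close> the 24-cell, and multiplication by \<open>a\<^sub>0\<close> is orthogonal.
\<close>

section \<open>Counting zeros of derivatives\<close>

text \<open>
  The derivatives are carried along as a sequence, as in the definition of absolute monotonicity.
  On an open interval they are two-sided.
\<close>

definition derivative_tower :: "real \<Rightarrow> real \<Rightarrow> (nat \<Rightarrow> real \<Rightarrow> real) \<Rightarrow> bool" where
  "derivative_tower a b G \<longleftrightarrow>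
     (\<forall>n. \<forall>x\<in>{a<..<b}. (G n has_real_derivative G (Suc n) x) (at x))"

lemma derivative_tower_shift:
  "derivative_tower a b G \<Longrightarrow> derivative_tower a b (\<lambda>n. G (k + n))"
  by (simp add: derivative_tower_def)

lemma derivative_tower_diff_poly:
  assumes "derivative_tower a b G"
  shows "derivative_tower a b (\<lambda>n x. G n x - poly ((pderiv ^^ n) p) x)"
  using assms unfolding derivative_tower_def
  by (auto intro!: derivative_eq_intros poly_DERIV)


text \<open>
  The new zeros lie strictly between consecutive old ones.  Their disjointness from the old zeros is
  what allows a double zero to be counted twice in \<open>Hermite_remainder\<close>: it contributes itself to the
  zeros of the derivative, in addition to the interlacing ones.  The bound by \<open>Max Z\<close> serves the induction,
  which adds the zeros in increasing order.
\<close>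

lemma Rolle_interlacing_zeros:
  fixes g g' :: "real \<Rightarrow> real"
  assumes "finite Z" and "Z \<noteq> {}" and "Z \<subseteq> {a<..<b}"
    and "\<And>z. z \<in> Z \<Longrightarrow> g z = 0"
    and der: "\<And>x. x \<in> {a<..<b} \<Longrightarrow> (g has_real_derivative g' x) (at x)"
  shows "\<exists>Y. Y \<subseteq> {a<..<Max Z} \<and> finite Y \<and> card Y = card Z - 1 \<and> Y \<inter> Z = {} \<and>
             (\<forall>y\<in>Y. g' y = 0)"
  using assms(1-4)
proof (induction Z rule: finite_linorder_max_induct)
  case empty
  then show ?case by simp
next
  case (insert m Z)
  show ?case
  proof (cases "Z = {}")
    case True
    then show ?thesis by (intro exI[of _ "{}"]) auto
  next
    case False
    with insert obtain Y where Y: "Y \<subseteq> {a<..<Max Z}" "finite Y" "card Y = card Z - 1"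
      "Y \<inter> Z = {}" "\<forall>y\<in>Y. g' y = 0"
      by auto
    define l where "l = Max Z"
    have l: "l \<in> Z" "\<And>z. z \<in> Z \<Longrightarrow> z \<le> l"
      using False insert.hyps by (auto simp: l_def)
    have "l < m" using l insert.hyps by auto
    have sub: "{l..m} \<subseteq> {a<..<b}"
      using l(1) insert.prems by auto
    obtain y where y: "l < y" "y < m" "g' y = 0"
    proof -
      have "\<exists>z>l. z < m \<and> (*) (g' z) = (\<lambda>v. 0)"
      proof (rule Rolle_deriv[OF \<open>l < m\<close>, where f = g])
        show "g l = g m" using l insert.prems by simp
        show "continuous_on {l..m} g"
          by (rule DERIV_continuous_on, rule has_field_derivative_at_within, rule der)
             (use sub in auto)
        show "(g has_derivative (*) (g' x)) (at x)" if "l < x" "x < m" for x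
          using der[unfolded has_field_derivative_def, of x] that sub
          by (meson atLeastAtMost_iff less_imp_le subsetD)
      qed
      then obtain z where "l < z" "z < m" "(*) (g' z) = (\<lambda>v. 0)" by blast
      then show ?thesis using that[of z] by (metis mult_1_right)
    qed
    have max: "Max (insert m Z) = m"
      using insert.hyps by (intro Max_eqI) auto
    have "y \<notin> Y" "y \<notin> Z" "m \<notin> Y" "m \<notin> Z"
      using Y(1) y l \<open>l < m\<close> unfolding l_def[symmetric] by force+
    moreover have "card Z > 0" using False insert.hyps by (simp add: card_gt_0_iff)
    moreover have "insert y Y \<subseteq> {a<..<m}"
      using Y(1) y l \<open>l < m\<close> sub unfolding l_def[symmetric] by force
    ultimately show ?thesis
      unfolding max using Y y insert.hyps
      by (intro exI[of _ "insert y Y"]) auto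
  qed
qed

lemma derivative_tower_Rolle:
  assumes "derivative_tower a b G" and "finite Z" and "card Z = Suc n" and "Z \<subseteq> {a<..<b}"
    and "\<And>z. z \<in> Z \<Longrightarrow> G 0 z = 0"
  shows "\<exists>\<xi>\<in>{a<..<b}. G n \<xi> = 0"
  using assms
proof (induction n arbitrary: G Z)
  case 0
  then obtain z where "z \<in> Z" by fastforce
  then show ?case using 0 by blast
next
  case (Suc n)
  have "Z \<noteq> {}" using Suc.prems by auto
  obtain Y where Y: "Y \<subseteq> {a<..<Max Z}" "finite Y" "card Y = card Z - 1"
      "\<forall>y\<in>Y. G (Suc 0) y = 0"
    using Rolle_interlacing_zeros[OF Suc.prems(2) \<open>Z \<noteq> {}\<close> Suc.prems(4), of "G 0" "G (Suc 0)"]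
      Suc.prems(1,5) unfolding derivative_tower_def by blast
  have "Max Z < b" using Suc.prems \<open>Z \<noteq> {}\<close> by (auto simp: subset_iff)
  then have "Y \<subseteq> {a<..<b}" using Y(1) by force
  then have "\<exists>\<xi>\<in>{a<..<b}. G (1 + n) \<xi> = 0"
    using Suc.prems(3) Y
    by (intro Suc.IH[OF derivative_tower_shift[OF Suc.prems(1), of 1], of Y]) auto
  then show ?case by simp
qed

section \<open>Hermite interpolation at double nodes\<close>

definition double_node_poly :: "real set \<Rightarrow> real poly" where
  "double_node_poly N = (\<Prod>c\<in>N. [:- c, 1:] ^ 2)"

lemma poly_double_node_poly: "poly (double_node_poly N) x = (\<Prod>c\<in>N. (x - c) ^ 2)"
  by (simp add: double_node_poly_def poly_prod)

lemma monic_double_node_poly: "lead_coeff (double_node_poly N) = 1"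
  by (simp add: double_node_poly_def lead_coeff_prod lead_coeff_power del: power_Suc)

lemma degree_double_node_poly:
  assumes "finite N"
  shows "degree (double_node_poly N) = 2 * card N"
  unfolding double_node_poly_def using assms
  by (subst degree_prod_eq_sum_degree) (auto simp: degree_power_eq)

lemma double_node_poly_root:
  assumes "finite N" and "c \<in> N"
  shows "poly (double_node_poly N) c = 0" and "poly (pderiv (double_node_poly N)) c = 0"
proof -
  have "double_node_poly N = [:- c, 1:] ^ 2 * double_node_poly (N - {c})"
    using assms by (simp add: double_node_poly_def prod.remove)
  then show "poly (double_node_poly N) c = 0" and "poly (pderiv (double_node_poly N)) c = 0"
    by (simp_all only: poly_mult pderiv_mult power2_eq_square poly_add) simp_all
qed

text \<open>
  Newton's scheme: once the conditions at the nodes in \<open>N\<close> are met, a multiple of the polynomial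
  vanishing doubly on \<open>N\<close> can be added without disturbing them, and a linear cofactor has just the two
  coefficients needed for the value and the slope at one more node.
\<close>

lemma Hermite_interpolant_exists:
  fixes v v' :: "real \<Rightarrow> real"
  assumes "finite N" and "N \<noteq> {}"
  shows "\<exists>p. degree p < 2 * card N \<and> (\<forall>c\<in>N. poly p c = v c \<and> poly (pderiv p) c = v' c)"
proof -
  have "\<exists>p. degree p \<le> 2 * card N - 1 \<and> (\<forall>c\<in>N. poly p c = v c \<and> poly (pderiv p) c = v' c)"
    using assms(1)
  proof (induction N)
    case empty
    then show ?case by (intro exI[of _ 0]) simp
  next
    case (insert d N)
    then obtain p where p: "degree p \<le> 2 * card N - 1"
      "\<And>c. c \<in> N \<Longrightarrow> poly p c = v c" "\<And>c. c \<in> N \<Longrightarrow> poly (pderiv p) c = v' c"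
      by blast
    define w where "w = double_node_poly N"
    have wd: "poly w d \<noteq> 0"
      using insert.hyps by (auto simp: w_def poly_double_node_poly)
    define \<alpha> where "\<alpha> = (v d - poly p d) / poly w d"
    define \<beta> where "\<beta> = (v' d - poly (pderiv p) d - \<alpha> * poly (pderiv w) d) / poly w d"
    define q where "q = p + w * [:\<alpha> - \<beta> * d, \<beta>:]"
    have "degree (w * [:\<alpha> - \<beta> * d, \<beta>:]) \<le> 2 * card N + 1"
      using degree_mult_le[of w "[:\<alpha> - \<beta> * d, \<beta>:]"] degree_double_node_poly[OF insert.hyps(1)]
      by (auto simp: w_def split: if_splits)
    then have "degree q \<le> 2 * card (insert d N) - 1"
      unfolding q_def using p(1) insert.hyps by (intro degree_add_le) auto
    moreover have "poly q c = v c \<and> poly (pderiv q) c = v' c" if "c \<in> insert d N" for c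
    proof (cases "c = d")
      case True
      have "poly q d = poly p d + \<alpha> * poly w d" by (simp add: q_def algebra_simps)
      then have "poly q d = v d"
        using wd by (simp add: \<alpha>_def)
      moreover have "poly (pderiv q) d = poly (pderiv p) d + \<alpha> * poly (pderiv w) d + \<beta> * poly w d"
        by (simp add: q_def pderiv_add pderiv_mult pderiv_pCons pderiv_smult algebra_simps)
      then have "poly (pderiv q) d = v' d"
        using wd by (simp add: \<beta>_def)
      ultimately show ?thesis using True by simp
    next
      case False
      then have "c \<in> N" using that by simp
      then show ?thesis
        using p(2,3) double_node_poly_root[OF insert.hyps(1)]
        by (simp add: q_def w_def pderiv_add pderiv_mult pderiv_pCons pderiv_smult)
    qed
    ultimately show ?case by blast
  qed
  moreover have "card N > 0" using assms by (simp add: card_gt_0_iff)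
  ultimately show ?thesis by (metis One_nat_def Suc_pred le_imp_less_Suc nat_0_less_mult_iff pos2)
qed

lemma poly_higher_pderiv_top:
  fixes q :: "real poly"
  assumes "degree q \<le> n"
  shows "poly ((pderiv ^^ n) q) x = fact n * coeff q n"
proof -
  have "degree ((pderiv ^^ n) q) = 0" using assms by (simp add: degree_higher_pderiv)
  then obtain c where c: "(pderiv ^^ n) q = [:c:]" by (rule degree_eq_zeroE)
  have "coeff ((pderiv ^^ n) q) 0 = fact n * coeff q n"
    by (simp add: coeff_higher_pderiv pochhammer_fact)
  then show ?thesis by (simp add: c)
qed

text \<open>
  Subtract from the function the interpolant plus the multiple of the nodal polynomial that makes the
  difference vanish at \<open>x\<close> as well.  For \<open>n\<close> nodes the difference has \<open>n + 1\<close> distinct zeros, its derivative has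
  \<open>n\<close> zeros between them and \<open>n\<close> more at the nodes, so the derivative of order \<open>2n\<close> vanishes somewhere.
\<close>

lemma Hermite_remainder:
  assumes tower: "derivative_tower a b G" and N: "finite N" "N \<subseteq> {a<..<b}"
    and p: "degree p < 2 * card N"
      "\<And>c. c \<in> N \<Longrightarrow> poly p c = G 0 c" "\<And>c. c \<in> N \<Longrightarrow> poly (pderiv p) c = G 1 c"
    and x: "x \<in> {a<..<b}" "x \<notin> N"
  shows "\<exists>\<xi>\<in>{a<..<b}. G 0 x - poly p x =
           G (2 * card N) \<xi> / fact (2 * card N) * (\<Prod>c\<in>N. (x - c) ^ 2)"
proof -
  define n where "n = card N"
  define w where "w = double_node_poly N"
  have wx: "poly w x \<noteq> 0"
    using x N by (auto simp: w_def poly_double_node_poly)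
  have wn: "degree w = 2 * n" "coeff w (2 * n) = 1"
    using degree_double_node_poly[OF N(1)] monic_double_node_poly[of N] by (auto simp: w_def n_def)
  define K where "K = (G 0 x - poly p x) / poly w x"
  define q where "q = p + smult K w"
  define F where "F = (\<lambda>k y. G k y - poly ((pderiv ^^ k) q) y)"
  have F: "derivative_tower a b F"
    unfolding F_def by (rule derivative_tower_diff_poly[OF tower])
  have F0: "F 0 c = 0" if "c \<in> insert x N" for c
    using that p(2) double_node_poly_root[OF N(1)] wx
    by (auto simp: F_def q_def K_def w_def)
  have F1: "F 1 c = 0" if "c \<in> N" for c
    using that p(3) double_node_poly_root[OF N(1)]
    by (auto simp: F_def q_def w_def pderiv_add pderiv_smult)
  have sub: "insert x N \<subseteq> {a<..<b}" using x N by auto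
  obtain Y where Y: "Y \<subseteq> {a<..<Max (insert x N)}" "finite Y" "card Y = n" "Y \<inter> insert x N = {}"
      "\<forall>y\<in>Y. F 1 y = 0"
    using Rolle_interlacing_zeros[of "insert x N" a b "F 0" "F 1"] sub F0 N x F[unfolded derivative_tower_def]
    by (auto simp: n_def)
  have "Max (insert x N) < b" using sub N by (subst Max_less_iff) auto
  then have Yab: "Y \<subseteq> {a<..<b}" using Y(1) by force
  have "n > 0" using p(1) by (simp add: n_def)
  have "card (Y \<union> N) = n + n"
    using Y N unfolding n_def by (subst card_Un_disjoint) auto
  then have "\<exists>\<xi>\<in>{a<..<b}. F (1 + (2 * n - 1)) \<xi> = 0"
    using Y N Yab F1 \<open>n > 0\<close>
    by (intro derivative_tower_Rolle[OF derivative_tower_shift[OF F, of 1], of "Y \<union> N"]) auto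
  then obtain \<xi> where \<xi>: "\<xi> \<in> {a<..<b}" "F (2 * n) \<xi> = 0" using \<open>n > 0\<close> by auto
  have "degree q \<le> 2 * n"
    unfolding q_def using p(1) wn degree_smult_le[of K w] by (intro degree_add_le) (auto simp: n_def)
  moreover have "coeff q (2 * n) = K"
    using p(1) wn by (simp add: q_def n_def coeff_eq_0)
  ultimately have "G (2 * n) \<xi> = fact (2 * n) * K"
    using \<xi>(2) by (simp add: F_def poly_higher_pderiv_top)
  then have "G 0 x - poly p x = G (2 * n) \<xi> / fact (2 * n) * poly w x"
    using wx by (simp add: K_def)
  then show ?thesis using \<xi>(1) by (auto simp: w_def n_def poly_double_node_poly)
qed

section \<open>Zeros of absolutely monotonic functions\<close>

lemma absolutely_monotonic_mono:
  assumes "derivative_tower a b G" and "\<And>n x. x \<in> {a<..<b} \<Longrightarrow> G n x \<ge> 0"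
    and "x \<in> {a<..<b}" "y \<in> {a<..<b}" "x \<le> y"
  shows "G n x \<le> G n y"
proof (rule DERIV_nonneg_imp_nondecreasing[OF \<open>x \<le> y\<close>])
  fix t assume "x \<le> t" "t \<le> y"
  then have "t \<in> {a<..<b}" using assms by auto
  then show "\<exists>D. (G n has_real_derivative D) (at t) \<and> 0 \<le> D"
    using assms(1,2) unfolding derivative_tower_def by blast
qed

text \<open>
  By induction every derivative attains its minimum 0 at \<open>c\<close>, an interior point.
\<close>

lemma absolutely_monotonic_zero_derivs:
  assumes G: "derivative_tower a b G" "\<And>n x. x \<in> {a<..<b} \<Longrightarrow> G n x \<ge> 0"
    and c: "c \<in> {a<..<b}" "G 0 c = 0"
  shows "G n c = 0"
proof (induction n)
  case (Suc n)
  have "(G n has_real_derivative G (Suc n) c) (at c)"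
    using G(1) c unfolding derivative_tower_def by blast
  moreover have "0 < min (c - a) (b - c)" using c by auto
  moreover have "\<forall>y. \<bar>c - y\<bar> < min (c - a) (b - c) \<longrightarrow> G n c \<le> G n y"
    using Suc G(2) by (auto simp: abs_if split: if_splits)
  ultimately show ?case by (rule DERIV_local_min)
qed (fact c)

text \<open>
  A quantitative form of Bernstein's theorem that absolutely monotonic functions are analytic.  The
  Taylor polynomials at \<open>c\<close> vanish, so the value at \<open>y\<close> is a remainder, which involves a derivative
  before \<open>y\<close>.  Derivatives increase, and the expansion at \<open>y\<close>, whose terms are all nonnegative, bounds
  the \<open>n\<close>-th derivative at some point after \<open>y\<close> by \<open>n! G(d) / (d - y)\<^sup>n\<close>.  The remainder is thus at most \<open>G(d)\<close> times the
  \<open>n\<close>-th power of \<open>(y - c)/(d - y) < 1\<close>; the hypothesis on \<open>y\<close> leaves room for such a \<open>d < b\<close>.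
\<close>

lemma absolutely_monotonic_zero_extends:
  assumes G: "derivative_tower a b G" "\<And>n x. x \<in> {a<..<b} \<Longrightarrow> G n x \<ge> 0"
    and c: "c \<in> {a<..<b}" "G 0 c = 0" and y: "c < y" "y < (b + c) / 2"
  shows "G 0 y = 0"
proof -
  \<comment> \<open>the midpoint of \<open>2y - c\<close> and \<open>b\<close>, so that \<open>d - y > y - c\<close> and \<open>d < b\<close>\<close>
  define d where "d = (2 * y - c + b) / 2"
  have d: "y < d" "d < b" "y - c < d - y" using y by (auto simp: d_def field_simps)
  define \<rho> where "\<rho> = (y - c) / (d - y)"
  have \<rho>: "0 \<le> \<rho>" "\<rho> < 1" using y d by (auto simp: \<rho>_def)
  have der: "\<forall>m t. m < n \<and> c \<le> t \<and> t \<le> d \<longrightarrow> (G m has_real_derivative G (Suc m) t) (at t)" for n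
    using G(1) c d unfolding derivative_tower_def by auto
  have yab: "y \<in> {a<..<b}" "d \<in> {a<..<b}" using c y d by auto
  have bound: "G 0 y \<le> \<rho> ^ n * G 0 d" if n: "n > 0" for n
  proof -
    obtain t where t: "c < t" "t < y"
      "G 0 y = (\<Sum>m<n. (G m c / fact m) * (y - c) ^ m) + (G n t / fact n) * (y - c) ^ n"
      using Taylor_up[of n G "G 0" c y c] der[of n] n y d by auto
    obtain s where s: "y < s" "s < d"
      "G 0 d = (\<Sum>m<n. (G m y / fact m) * (d - y) ^ m) + (G n s / fact n) * (d - y) ^ n"
      using Taylor_up[of n G "G 0" c d y] der[of n] n y d by auto
    have "G 0 y = (G n t / fact n) * (y - c) ^ n"
      using t(3) absolutely_monotonic_zero_derivs[OF G c] by simp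
    also have "\<dots> \<le> (G n s / fact n) * (y - c) ^ n"
      using absolutely_monotonic_mono[OF G, of t s n] t s c d y
      by (intro mult_right_mono divide_right_mono) auto
    also have "\<dots> = \<rho> ^ n * ((G n s / fact n) * (d - y) ^ n)"
      using d by (simp add: \<rho>_def power_divide)
    also have "(\<Sum>m<n. (G m y / fact m) * (d - y) ^ m) \<ge> 0"
      using G(2)[OF yab(1)] d by (intro sum_nonneg) auto
    then have "\<rho> ^ n * ((G n s / fact n) * (d - y) ^ n) \<le> \<rho> ^ n * G 0 d"
      using s(3) \<rho> by (intro mult_left_mono) auto
    finally show ?thesis .
  qed
  have "(\<lambda>n. \<rho> ^ n * G 0 d) \<longlonglongrightarrow> 0 * G 0 d"
    using \<rho> by (intro tendsto_intros LIMSEQ_power_zero) auto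
  then have "G 0 y \<le> 0 * G 0 d"
    by (rule Lim_bounded2[of _ _ 1]) (use bound in auto)
  then show ?thesis using G(2)[OF yab(1), of 0] by simp
qed

text \<open>
  The zeros form an initial segment of the interval.  If its supremum \<open>s\<close> were less than \<open>b\<close>, the
  previous lemma applied to a zero close to \<open>s\<close> would give zeros beyond \<open>s\<close>.
\<close>

lemma absolutely_monotonic_eq_0:
  assumes G: "derivative_tower a b G" "\<And>n x. x \<in> {a<..<b} \<Longrightarrow> G n x \<ge> 0"
    and c: "c \<in> {a<..<b}" "G 0 c = 0" and y: "y \<in> {a<..<b}"
  shows "G 0 y = 0"
proof (rule ccontr)
  assume y0: "G 0 y \<noteq> 0"
  define Z where "Z = {x \<in> {a<..<b}. G 0 x = 0}"
  have ub: "z \<le> y" if "z \<in> Z" for z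
    using absolutely_monotonic_mono[OF G, of y z 0] y0 that y G(2)[OF y, of 0] by (force simp: Z_def)
  then have bdd: "bdd_above Z" by (auto simp: bdd_above_def)
  have ne: "c \<in> Z" using c by (simp add: Z_def)
  define s where "s = Sup Z"
  have s: "c \<le> s" "s \<le> y"
    using cSup_upper[OF ne bdd] cSup_least[of Z y] ne ub by (auto simp: s_def)
  then have "2 * s - b < s" using y by simp
  then obtain z where z: "z \<in> Z" "2 * s - b < z"
    using less_cSup_iff[OF _ bdd] ne unfolding s_def[symmetric] by blast
  define x where "x = (s + (b + z) / 2) / 2"
  have zs: "z \<le> s" using cSup_upper[OF z(1) bdd] by (simp add: s_def)
  have x: "s < x" "x < (b + z) / 2" using z by (auto simp: x_def field_simps)
  have "G 0 x = 0"
    using absolutely_monotonic_zero_extends[OF G, of z x] z x zs by (auto simp: Z_def)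
  moreover have "x \<in> {a<..<b}" using x zs z by (auto simp: Z_def)
  ultimately have "x \<le> s" using cSup_upper[of x Z] bdd by (auto simp: Z_def s_def)
  then show False using x by simp
qed

section \<open>Sums over a hexagon\<close>

lemma unit_mult_cnj: "cmod z = 1 \<Longrightarrow> z * cnj z = 1"
  using complex_norm_square[of z] by simp

text \<open>
  Up to a factor, the interaction of two hexagons whose axes have Hermitian product \<open>z/\<surd>3\<close>.
\<close>

definition hexagon_sum :: "(real \<Rightarrow> real) \<Rightarrow> complex \<Rightarrow> real" where
  "hexagon_sum f z = (\<Sum>w\<in>mu6. f (sqrt (1/3) * Re (z * w)))"

lemma bij_betw_mu6: "bij_betw (\<lambda>k. cis (pi * real k / 3)) {..<6} mu6"
proof -
  have "(\<lambda>k. cis (2 * pi * real k / real 6)) = (\<lambda>k. cis (pi * real k / 3))"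
    by (simp add: fun_eq_iff)
  moreover have "bij_betw (\<lambda>k. cis (2 * pi * real k / real 6)) {..<6} {z. z ^ 6 = 1}"
    by (rule Complex.bij_betw_roots_unity) simp
  ultimately show ?thesis by (simp only: mu6_def)
qed

lemma finite_mu6: "finite mu6" and card_mu6: "card mu6 = 6"
  using bij_betw_finite[OF bij_betw_mu6] bij_betw_same_card[OF bij_betw_mu6] by auto

lemma norm_mu6:
  assumes "w \<in> mu6"
  shows "cmod w = 1"
proof -
  have "cmod w ^ 6 = 1" using assms by (simp add: mu6_def flip: norm_power)
  then show ?thesis using power_eq_imp_eq_base[of "cmod w" 6 1] by simp
qed

lemma mult_mu6:
  assumes "w \<in> mu6"
  shows "(*) w ` mu6 = mu6"
proof
  show "(*) w ` mu6 \<subseteq> mu6" using assms by (auto simp: mu6_def power_mult_distrib)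
  show "mu6 \<subseteq> (*) w ` mu6"
  proof
    fix v assume "v \<in> mu6"
    then have "cnj w * v \<in> mu6"
      using assms by (simp add: mu6_def power_mult_distrib flip: complex_cnj_power)
    moreover have "v = w * (cnj w * v)"
      using unit_mult_cnj[OF norm_mu6[OF assms]] by (simp flip: mult.assoc)
    ultimately show "v \<in> (*) w ` mu6" by (rule rev_image_eqI)
  qed
qed

lemma hexagon_sum_explicit:
  fixes f :: "real \<Rightarrow> real" and z :: complex
  defines "X \<equiv> sqrt (1/3) * Re z" and "Y \<equiv> Im z"
  shows "hexagon_sum f z =
    f X + f ((X - Y) / 2) + f (- (X + Y) / 2) + f (- X) + f (- (X - Y) / 2) + f ((X + Y) / 2)"
proof -
  have s3: "sqrt 3 * sqrt (1/3) = 1" by (simp flip: real_sqrt_mult)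
  have c: "cos (pi * 2 / 3) = - 1/2" "sin (pi * 2 / 3) = sqrt 3 / 2"
    using cos_120 sin_120 by (simp_all add: mult.commute)
  have c4: "cos (pi * 4 / 3) = - 1/2" "sin (pi * 4 / 3) = - sqrt 3 / 2"
    using cos_periodic_pi[of "pi/3"] sin_periodic_pi[of "pi/3"] cos_60 sin_60
    by (simp_all add: field_simps)
  have c5: "cos (pi * 5 / 3) = 1/2" "sin (pi * 5 / 3) = - sqrt 3 / 2"
    using cos_periodic_pi[of "pi*2/3"] sin_periodic_pi[of "pi*2/3"] c
    by (simp_all add: field_simps)
  have "hexagon_sum f z = (\<Sum>k<6. f (sqrt (1/3) * Re (z * cis (pi * real k / 3))))"
    unfolding hexagon_sum_def by (rule sum.reindex_bij_betw[OF bij_betw_mu6, symmetric])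
  also have "{..<6::nat} = {0,1,2,3,4,5}" by auto
  finally show ?thesis
    by (simp add: s3 c c4 c5 cos_60 sin_60 X_def Y_def field_simps minus_diff_commute)
qed

lemma hexagon_sum_i: "hexagon_sum f \<i> = 2 * (f 0 + f (1/2) + f (- 1/2))"
  by (simp add: hexagon_sum_explicit)

lemma hexagon_sum_minus_i: "hexagon_sum f (- \<i>) = hexagon_sum f \<i>"
  by (simp add: hexagon_sum_explicit)

text \<open>
  The 5-design property of the hexagon.  Odd powers cancel because the six arguments come in opposite
  pairs; their second and fourth power sums are \<open>3X\<^sup>2 + Y\<^sup>2 = 1\<close> and \<open>(3X\<^sup>2 + Y\<^sup>2)\<^sup>2/4\<close> with \<open>X\<close>, \<open>Y\<close> as in
  \<open>hexagon_sum_explicit\<close>.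
\<close>

lemma hexagon_sum_poly:
  assumes "degree p \<le> 5" and "cmod z = 1"
  shows "hexagon_sum (poly p) z = hexagon_sum (poly p) \<i>"
proof -
  define X Y where "X = sqrt (1/3) * Re z" and "Y = Im z"
  have "Re z ^ 2 + Im z ^ 2 = 1" using assms(2) by (simp add: cmod_def)
  then have XY: "3 * X ^ 2 + Y ^ 2 = 1"
    by (simp add: X_def Y_def power_mult_distrib)
  define c where "c = coeff p"
  have p: "poly p x = c 0 + c 1 * x + c 2 * x^2 + c 3 * x^3 + c 4 * x^4 + c 5 * x^5" for x
  proof -
    have "poly p x = (\<Sum>i\<le>5. c i * x ^ i)"
      unfolding poly_altdef c_def using assms(1) by (intro sum.mono_neutral_left) (auto simp: coeff_eq_0)
    also have "{..5::nat} = {0,1,2,3,4,5}" by auto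
    finally show ?thesis by (simp add: add_ac)
  qed
  have "hexagon_sum (poly p) z
      = 6 * c 0 + c 2 * (3 * X ^ 2 + Y ^ 2) + c 4 * (3 * X ^ 2 + Y ^ 2) ^ 2 / 4"
    unfolding hexagon_sum_explicit p X_def[symmetric] Y_def[symmetric]
    by (simp add: field_simps power_numeral_reduce)
  moreover have "hexagon_sum (poly p) \<i> = 6 * c 0 + c 2 + c 4 / 4"
    unfolding hexagon_sum_i p by (simp add: field_simps power_numeral_reduce)
  ultimately show ?thesis using XY by simp
qed

text \<open>
  The hypothesis on \<open>Re z\<close> says that \<open>z\<close> has argument \<open>\<pi>/6\<close> modulo \<open>\<pi>/3\<close>; the proof uses
  \<open>Re (z\<^sup>6) + 1 = 2x\<^sup>2(4x\<^sup>2 - 3)\<^sup>2\<close> for \<open>z = x + iy\<close> on the unit circle.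
\<close>

lemma root_of_minus_one:
  assumes "cmod z = 1" and "sqrt (1/3) * Re z \<in> {0, 1/2, - 1/2}"
  shows "z ^ 6 = - 1"
proof -
  obtain x y where z: "z = Complex x y" by (cases z)
  have xy: "x ^ 2 + y ^ 2 = 1" using assms(1) by (simp add: cmod_def z)
  have e: "z ^ 6 = Complex (x^6 - 15 * x^4 * y^2 + 15 * x^2 * y^4 - y^6)
      (2 * x * y * (3 * x^2 - y^2) * (x^2 - 3 * y^2))"
    by (simp add: z complex_eq_iff power_numeral_reduce field_simps)
  have y2: "y ^ 2 = 1 - x ^ 2" using xy by simp
  have y4: "y ^ 4 = (1 - x^2)^2" "y ^ 6 = (1 - x^2)^3"
    unfolding y2[symmetric] by (simp_all flip: power_mult)
  have re: "x^6 - 15 * x^4 * y^2 + 15 * x^2 * y^4 - y^6 = 2 * x^2 * (4 * x^2 - 3)^2 - 1"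
    unfolding y2 y4 by (simp add: power_numeral_reduce field_simps)
  have "(sqrt (1/3) * x)^2 = 0 \<or> (sqrt (1/3) * x)^2 = 1/4"
    using assms(2) by (auto simp only: z complex.sel insert_iff empty_iff power2_eq_square)
  then have "x = 0 \<or> x ^ 2 = 3/4" by (auto simp: power_mult_distrib)
  then show ?thesis
    unfolding e re using y2 by (auto simp: complex_eq_iff)
qed

section \<open>Minimizing the interaction of two hexagons\<close>

lemma absolutely_monotonic_tower:
  assumes "absolutely_monotonic f"
  obtains G where "derivative_tower (-1) 1 G" "\<And>n x. x \<in> {-1<..<1} \<Longrightarrow> G n x \<ge> 0"
    "\<And>x. x \<in> {-1<..<1} \<Longrightarrow> G 0 x = f x" "continuous_on {-1..<1} f"
proof -
  obtain G where G: "\<And>x. x \<in> {-1..<1} \<Longrightarrow> G 0 x = f x"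
    "\<And>n x. x \<in> {-1..<1} \<Longrightarrow> (G n has_real_derivative G (Suc n) x) (at x within {-1..<1})"
    "\<And>n x. x \<in> {-1..<1} \<Longrightarrow> G n x \<ge> 0"
    using assms unfolding absolutely_monotonic_def by blast
  have "derivative_tower (-1) 1 G"
    unfolding derivative_tower_def
  proof (intro allI ballI)
    fix n and x :: real assume x: "x \<in> {-1<..<1}"
    then have "at x within {-1..<1} = at x" by (intro at_within_interior) (simp add: interior_atLeastLessThan)
    then show "(G n has_real_derivative G (Suc n) x) (at x)" using G(2)[of x n] x by simp
  qed
  moreover have "continuous_on {-1..<1} (G 0)"
    by (rule DERIV_continuous_on[OF G(2)])
  then have "continuous_on {-1..<1} f" by (rule continuous_on_eq) (rule G(1))
  ultimately show ?thesis using that[of G] G by simp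
qed

text \<open>
  The double contact at \<open>0, 1/2, -1/2\<close> makes the nodal polynomial a square, so the sign of the error is
  that of the sixth derivative.  The exceptional case is that this derivative has a zero: then it
  vanishes on the whole interval, and the same error formula shows that \<open>f\<close> is the interpolant.
\<close>

lemma quintic_minorant:
  assumes "absolutely_monotonic f"
  shows "\<exists>p. degree p \<le> 5 \<and> (\<forall>c\<in>{0, 1/2, - 1/2}. poly p c = f c) \<and>
     (\<forall>x\<in>{-1<..<1}. poly p x \<le> f x) \<and>
     (\<not> poly_degree_le_on {-1..<1} 5 f \<longrightarrow>
        (\<forall>x\<in>{-1<..<1} - {0, 1/2, - 1/2}. poly p x < f x))"
proof -
  define N :: "real set" where "N = {0, 1/2, - 1/2}"
  have N: "finite N" "N \<noteq> {}" "card N = 3" "N \<subseteq> {-1<..<1}" by (auto simp: N_def)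
  obtain G where G: "derivative_tower (-1) 1 G" "\<And>n x. x \<in> {-1<..<1} \<Longrightarrow> G n x \<ge> 0"
    "\<And>x. x \<in> {-1<..<1} \<Longrightarrow> G 0 x = f x" "continuous_on {-1..<1} f"
    using absolutely_monotonic_tower[OF assms] by blast
  obtain p where p: "degree p < 2 * card N" "\<And>c. c \<in> N \<Longrightarrow> poly p c = G 0 c"
    "\<And>c. c \<in> N \<Longrightarrow> poly (pderiv p) c = G 1 c"
    using Hermite_interpolant_exists[OF N(1,2), of "G 0" "G 1"] by blast
  have deg: "degree p \<le> 5" using p(1) N by simp
  have node: "poly p c = f c" if "c \<in> N" for c using p(2) G(3) N(4) that by auto
  have rem: "\<exists>\<xi>\<in>{-1<..<1}. \<exists>k>0. f x - poly p x = G 6 \<xi> * k" if x: "x \<in> {-1<..<1}" "x \<notin> N" for x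
  proof -
    obtain \<xi> where \<xi>: "\<xi> \<in> {-1<..<1}"
      "G 0 x - poly p x = G (2 * card N) \<xi> / fact (2 * card N) * (\<Prod>c\<in>N. (x - c) ^ 2)"
      using Hermite_remainder[OF G(1) N(1,4) p x] by blast
    have "(\<Prod>c\<in>N. (x - c) ^ 2) > 0" using x(2) by (intro prod_pos) auto
    then have "(\<Prod>c\<in>N. (x - c) ^ 2) / fact 6 > 0" by (intro divide_pos_pos) auto
    moreover have "f x - poly p x = G 6 \<xi> * ((\<Prod>c\<in>N. (x - c) ^ 2) / fact 6)"
      using \<xi>(2) G(3)[OF x(1)] N(3) by simp
    ultimately show ?thesis using \<xi>(1) by blast
  qed
  have le: "poly p x \<le> f x" if x: "x \<in> {-1<..<1}" for x
  proof (cases "x \<in> N")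
    case False
    then obtain \<xi> k where "\<xi> \<in> {-1<..<1}" "k > 0" "f x - poly p x = G 6 \<xi> * k"
      using rem[OF x False] by blast
    moreover from this have "0 \<le> G 6 \<xi> * k" by (intro mult_nonneg_nonneg G(2)) auto
    ultimately show ?thesis by linarith
  qed (simp add: node)
  have less: "poly p x < f x" if np: "\<not> poly_degree_le_on {-1..<1} 5 f"
    and x: "x \<in> {-1<..<1}" "x \<notin> N" for x
  proof (rule ccontr)
    assume "\<not> poly p x < f x"
    then have "f x - poly p x = 0" using le[OF x(1)] by simp
    moreover obtain \<xi> k where "\<xi> \<in> {-1<..<1}" "k > 0" "f x - poly p x = G 6 \<xi> * k"
      using rem[OF x] by blast
    ultimately have \<xi>: "\<xi> \<in> {-1<..<1}" "G (6 + 0) \<xi> = 0" by auto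
    have zero: "G 6 y = 0" if "y \<in> {-1<..<1}" for y
      using absolutely_monotonic_eq_0[OF derivative_tower_shift[OF G(1), of 6] G(2) \<xi> that] by simp
    have "f y = poly p y" if y: "y \<in> {-1<..<1}" for y
    proof (cases "y \<in> N")
      case False
      then obtain \<xi>' k where "\<xi>' \<in> {-1<..<1}" "f y - poly p y = G 6 \<xi>' * k"
        using rem[OF y False] by blast
      then show ?thesis using zero by simp
    qed (simp add: node)
    then have eq: "f y - poly p y = 0" if "y \<in> {-1<..<1}" for y using that by simp
    \<comment> \<open>the error formula covers the open interval only; the endpoint follows by continuity\<close>
    have "f (-1) - poly p (-1) = 0"
    proof (rule continuous_constant_on_closure[of "{-1<..<0}" "\<lambda>y. f y - poly p y"])
      have "closure {-1<..<0::real} \<subseteq> {-1..<1}" by (simp add: subset_iff)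
      then show "continuous_on (closure {-1<..<0}) (\<lambda>y. f y - poly p y)"
        by (intro continuous_intros continuous_on_subset[OF G(4)])
    qed (simp_all add: eq)
    with eq have "f y - poly p y = 0" if "y \<in> {-1..<1}" for y
      using that by (cases "y = -1") simp_all
    then have "\<forall>y\<in>{-1..<1}. f y = poly p y" by simp
    then show False using np deg unfolding poly_degree_le_on_def by blast
  qed
  show ?thesis
    unfolding N_def[symmetric] using deg node le less by (intro exI[of _ p]) simp
qed

text \<open>
  For \<open>z = \<i>\<close> all arguments are interpolation nodes, so the quintic minorant \<open>p\<close> gives
  \<open>hexagon_sum f \<i> = hexagon_sum p \<i> = hexagon_sum p z \<le> hexagon_sum f z\<close>.  Strictness of \<open>p < f\<close> off the nodes
  makes the last step strict as soon as one argument is not a node; the argument for \<open>w = 1\<close> is enough.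
\<close>

lemma hexagon_sum_minimum:
  assumes f: "absolutely_monotonic f" and z: "cmod z = 1"
  shows "hexagon_sum f \<i> \<le> hexagon_sum f z"
    and "\<not> poly_degree_le_on {-1..<1} 5 f \<Longrightarrow> hexagon_sum f \<i> = hexagon_sum f z \<Longrightarrow> z ^ 6 = - 1"
proof -
  obtain p where p: "degree p \<le> 5" "\<forall>c\<in>{0, 1/2, - 1/2}. poly p c = f c"
     "\<forall>x\<in>{-1<..<1}. poly p x \<le> f x"
     "\<not> poly_degree_le_on {-1..<1} 5 f \<longrightarrow>
        (\<forall>x\<in>{-1<..<1} - {0, 1/2, - 1/2}. poly p x < f x)"
    using quintic_minorant[OF f] by (elim exE conjE) (rule that)
  have base: "hexagon_sum f \<i> = hexagon_sum (poly p) z"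
    unfolding hexagon_sum_poly[OF p(1) z] hexagon_sum_i using p(2) by simp
  have range: "sqrt (1/3) * Re (z * w) \<in> {-1<..<1}" if "w \<in> mu6" for w
  proof -
    have "cmod w = 1" by (rule norm_mu6[OF that])
    then have "\<bar>Re (z * w)\<bar> \<le> 1" using abs_Re_le_cmod[of "z * w"] z by (simp add: norm_mult)
    then have "\<bar>sqrt (1/3) * Re (z * w)\<bar> \<le> sqrt (1/3)" by (simp add: abs_mult mult_left_le)
    also have "sqrt (1/3) < (1::real)" by simp
    finally show ?thesis by auto
  qed
  have one: "1 \<in> mu6" by (simp add: mu6_def)
  have "hexagon_sum (poly p) z \<le> hexagon_sum f z"
    unfolding hexagon_sum_def by (intro sum_mono p(3)[rule_format] range)
  then show "hexagon_sum f \<i> \<le> hexagon_sum f z" by (simp only: base)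
  assume np: "\<not> poly_degree_le_on {-1..<1} 5 f" and eq: "hexagon_sum f \<i> = hexagon_sum f z"
  have "sqrt (1/3) * Re z \<in> {0, 1/2, - 1/2}"
  proof (rule ccontr)
    assume n: "sqrt (1/3) * Re z \<notin> {0, 1/2, - 1/2}"
    have "hexagon_sum (poly p) z < hexagon_sum f z"
      unfolding hexagon_sum_def
    proof (rule sum_strict_mono_ex1[OF finite_mu6])
      show "\<exists>w\<in>mu6. poly p (sqrt (1/3) * Re (z * w)) < f (sqrt (1/3) * Re (z * w))"
        using p(4) np n range[OF one] one by (intro bexI[of _ 1]) auto
    qed (intro ballI p(3)[rule_format] range)
    then show False using eq base by simp
  qed
  then show "z ^ 6 = - 1" by (rule root_of_minus_one[OF z])
qed

section \<open>Energy in terms of hexagon sums\<close>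

text \<open>
  The points of \<open>H\<^sub>m\<close> are the multiples of \<open>hexagon_axis m\<close> by sixth roots of unity, for \<open>m < 4\<close>.
\<close>

definition hexagon_axis :: "nat \<Rightarrow> complex \<times> complex" where
  "hexagon_axis m = [(1, 0), (u_D4 * \<i>, t_D4 * \<i>), (u_D4 * \<i>, r_D4 * t_D4 * \<i>),
                     (u_D4 * \<i>, cnj r_D4 * t_D4 * \<i>)] ! m"

definition hexagon_point :: "(nat \<Rightarrow> complex) \<Rightarrow> nat \<times> complex \<Rightarrow> complex \<times> complex" where
  "hexagon_point a = (\<lambda>(m, w). (a m * w * fst (hexagon_axis m), a m * w * snd (hexagon_axis m)))"

definition axis_product :: "nat \<Rightarrow> nat \<Rightarrow> complex" where
  "axis_product m n = fst (hexagon_axis m) * cnj (fst (hexagon_axis n)) +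
                      snd (hexagon_axis m) * cnj (snd (hexagon_axis n))"

lemma less_4_cases: "(m::nat) < 4 \<Longrightarrow> m = 0 \<or> m = 1 \<or> m = 2 \<or> m = 3"
  by auto

lemma r_D4_eq: "r_D4 = Complex (- 1/2) (sqrt 3 / 2)"
proof -
  have "r_D4 = cis (2 * pi / 3)" by (simp add: r_D4_def cis_conv_exp mult_ac)
  then show ?thesis using cos_120 sin_120 by (simp add: complex_eq_iff)
qed

lemma D4_constants:
  "cnj u_D4 = u_D4" "cnj t_D4 = t_D4" "u_D4 * u_D4 = 1/3" "t_D4 * t_D4 = 2/3"
  "t_D4 * (t_D4 * x) = 2/3 * x"
proof -
  show t: "t_D4 * t_D4 = 2/3"
    unfolding t_D4_def by (simp flip: of_real_mult add: complex_eq_iff)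
  show "t_D4 * (t_D4 * x) = 2/3 * x" using t by (metis mult.assoc)
  show "u_D4 * u_D4 = 1/3"
    unfolding u_D4_def by (simp flip: of_real_mult)
qed (simp_all add: u_D4_def t_D4_def)

lemma axis_product_self:
  assumes "m < 4"
  shows "axis_product m m = 1"
proof -
  have r: "r_D4 * (cnj r_D4 * x) = x" for x
    by (simp add: r_D4_eq complex_eq_iff algebra_simps)
  show ?thesis
    using less_4_cases[OF assms]
    by (auto simp: axis_product_def hexagon_axis_def D4_constants r mult_ac)
qed

text \<open>
  From \<open>u\<^sup>2 + t\<^sup>2 r = 1/3 + 2r/3 = \<i>/\<surd>3\<close>: all pairs of different hexagons are in the same relative
  position up to conjugation.
\<close>

lemma axis_product_distinct:
  assumes "m < 4" "n < 4" "m \<noteq> n"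
  shows "\<exists>\<kappa>\<in>{\<i>, - \<i>}. axis_product m n = complex_of_real (sqrt (1/3)) * \<kappa>"
proof -
  have s3: "sqrt 3 / 3 = sqrt (1/3)"
    by (simp add: real_sqrt_divide field_simps)
  have r: "1/3 + 2/3 * r_D4 = u_D4 * \<i>" "1/3 + 2/3 * cnj r_D4 = - u_D4 * \<i>"
    using s3 by (simp_all add: r_D4_eq complex_eq_iff u_D4_def)
  have rr: "r_D4 * r_D4 = cnj r_D4" "cnj r_D4 * cnj r_D4 = r_D4"
    "r_D4 * (r_D4 * x) = cnj r_D4 * x" "cnj r_D4 * (cnj r_D4 * x) = r_D4 * x" for x
    by (simp_all add: r_D4_eq complex_eq_iff algebra_simps)
  consider "m = 0" "n \<in> {1,2,3}" | "n = 0" "m \<in> {1,2,3}" | "m = 1" "n = 2" | "m = 1" "n = 3"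
    | "m = 2" "n = 1" | "m = 2" "n = 3" | "m = 3" "n = 1" | "m = 3" "n = 2"
    using assms less_4_cases[of m] less_4_cases[of n] by auto
  then show ?thesis
    using r unfolding u_D4_def[symmetric]
    by cases (auto simp: axis_product_def hexagon_axis_def D4_constants rr mult_ac)
qed

lemma sqrt3_axis_product:
  assumes "m < 4" "n < 4" "m \<noteq> n"
  shows "complex_of_real (sqrt 3) * axis_product m n \<in> {\<i>, - \<i>}"
proof -
  have "complex_of_real (sqrt 3) * complex_of_real (sqrt (1/3)) = 1"
    by (simp flip: of_real_mult real_sqrt_mult)
  moreover obtain \<kappa> where \<kappa>: "\<kappa> \<in> {\<i>, - \<i>}" "axis_product m n = complex_of_real (sqrt (1/3)) * \<kappa>"
    using axis_product_distinct[OF assms] by blast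
  ultimately have "complex_of_real (sqrt 3) * axis_product m n = \<kappa>"
    by (metis mult.assoc mult_1)
  then show ?thesis using \<kappa>(1) by simp
qed

lemma inner_hexagon_point:
  "inner (hexagon_point a (m, w)) (hexagon_point a (n, w')) =
     Re (a m * cnj (a n) * axis_product m n * (w * cnj w'))"
  unfolding hexagon_point_def prod.case inner_C2
  by (rule arg_cong[where f = Re]) (simp add: axis_product_def algebra_simps)

lemma D_config_eq_image:
  "D_config (a 0) (a 1) (a 2) (a 3) = hexagon_point a ` ({..<4} \<times> mu6)"
proof -
  have "{..<4::nat} = {0,1,2,3}" by auto
  then have "hexagon_point a ` ({..<4} \<times> mu6) =
    (\<lambda>w. hexagon_point a (0, w)) ` mu6 \<union> (\<lambda>w. hexagon_point a (1, w)) ` mu6 \<union>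
    (\<lambda>w. hexagon_point a (2, w)) ` mu6 \<union> (\<lambda>w. hexagon_point a (3, w)) ` mu6"
    by auto
  moreover have "cscale (a 0) H0 = (\<lambda>w. hexagon_point a (0, w)) ` mu6"
    "cscale (a 1) H1 = (\<lambda>w. hexagon_point a (1, w)) ` mu6"
    "cscale (a 2) H2 = (\<lambda>w. hexagon_point a (2, w)) ` mu6"
    "cscale (a 3) H3 = (\<lambda>w. hexagon_point a (3, w)) ` mu6"
    unfolding cscale_def H0_def H1_def H2_def H3_def image_image hexagon_point_def
    by (simp_all add: hexagon_axis_def mult_ac)
  ultimately show ?thesis by (simp add: D_config_def)
qed

lemma sum_mu6_quotient:
  assumes "w \<in> mu6"
  shows "(\<Sum>w'\<in>mu6. F (w * cnj w')) = (\<Sum>w'\<in>mu6. F w')"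
proof (rule sum.reindex_bij_witness[of _ "\<lambda>v. w * cnj v" "\<lambda>v. w * cnj v"])
  have w: "w * cnj w = 1" by (rule unit_mult_cnj[OF norm_mu6[OF assms]])
  show "w * cnj (w * cnj v) = v" for v
    using w by (simp flip: mult.assoc)
  then show "w * cnj (w * cnj v) = v" for v .
  show "w * cnj v \<in> mu6" if "v \<in> mu6" for v
    using assms that by (simp add: mu6_def power_mult_distrib flip: complex_cnj_power)
  then show "w * cnj v \<in> mu6" if "v \<in> mu6" for v using that .
qed simp

text \<open>
  Equal points have inner product 1, whereas points of different hexagons have inner product at most
  \<open>1/\<surd>3\<close>; hence the hexagons stay disjoint for all phases.
\<close>

lemma inj_on_hexagon_point:
  assumes a: "\<And>m. m < 4 \<Longrightarrow> cmod (a m) = 1"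
  shows "inj_on (hexagon_point a) ({..<4} \<times> mu6)"
proof (rule inj_onI, clarify)
  fix m w n w'
  assume m: "m < 4" and n: "n < 4" and w: "w \<in> mu6" "w' \<in> mu6"
    and eq: "hexagon_point a (m, w) = hexagon_point a (n, w')"
  have self: "a m * cnj (a m) = 1" "w * cnj w = 1"
    by (rule unit_mult_cnj[OF a[OF m]], rule unit_mult_cnj[OF norm_mu6[OF w(1)]])
  have "inner (hexagon_point a (m, w)) (hexagon_point a (n, w')) = 1"
    unfolding eq[symmetric] inner_hexagon_point by (simp add: self axis_product_self[OF m])
  then have re: "Re (a m * cnj (a n) * axis_product m n * (w * cnj w')) = 1"
    by (simp add: inner_hexagon_point)
  have "1 \<le> cmod (a m * cnj (a n) * axis_product m n * (w * cnj w'))"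
    using re complex_Re_le_cmod[of "a m * cnj (a n) * axis_product m n * (w * cnj w')"] by simp
  then have "1 \<le> cmod (axis_product m n)"
    using a[OF m] a[OF n] norm_mu6[OF w(1)] norm_mu6[OF w(2)] by (simp add: norm_mult)
  moreover have "cmod (axis_product m n) < 1" if "m \<noteq> n"
    using axis_product_distinct[OF m n that] by (auto simp: norm_mult)
  ultimately have "m = n" by force
  moreover have "hexagon_axis m \<noteq> (0, 0)"
    using axis_product_self[OF m] by (auto simp: axis_product_def)
  ultimately show "m = n \<and> w = w'"
    using eq a[OF m] by (auto simp: hexagon_point_def prod_eq_iff)
qed

text \<open>
  For fixed \<open>w\<close> the quotients \<open>w * cnj w'\<close> run through \<open>\<mu>\<^sub>6\<close>, so each of the six points of hexagon \<open>m\<close> sees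
  hexagon \<open>n\<close> through the same hexagon sum.
\<close>

lemma energy_D_config:
  assumes a: "\<And>m. m < 4 \<Longrightarrow> cmod (a m) = 1"
  shows "energy f (D_config (a 0) (a 1) (a 2) (a 3)) =
    4 * (\<Sum>w\<in>mu6. \<Sum>w'\<in>mu6 - {w}. f (Re (w * cnj w'))) +
    6 * (\<Sum>m<4. \<Sum>n\<in>{..<4} - {m}.
           hexagon_sum f (a m * cnj (a n) * (sqrt 3 * axis_product m n)))"
proof -
  define P where "P = hexagon_point a"
  define I where "I = {..<4::nat} \<times> mu6"
  define R where "R = (\<lambda>m. \<Sum>n\<in>{..<4} - {m}.
           hexagon_sum f (a m * cnj (a n) * (sqrt 3 * axis_product m n)))"
  have inj: "inj_on P I" unfolding P_def I_def by (rule inj_on_hexagon_point[OF a])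
  have row: "(\<Sum>c'\<in>P ` I - {P (m, w)}. f (inner (P (m, w)) c')) =
      (\<Sum>w'\<in>mu6 - {w}. f (Re (w * cnj w'))) + R m" if m: "m < 4" and w: "w \<in> mu6" for m w
  proof -
    have mw: "(m, w) \<in> I" using m w by (simp add: I_def)
    have "P ` I - {P (m, w)} = P ` (I - {(m, w)})"
      using inj_on_image_set_diff[OF inj, of I "{(m, w)}"] mw by simp
    moreover have "inj_on P (I - {(m, w)})" by (rule inj_on_subset[OF inj]) auto
    ultimately have "(\<Sum>c'\<in>P ` I - {P (m, w)}. f (inner (P (m, w)) c')) =
        (\<Sum>s\<in>I - {(m, w)}. f (inner (P (m, w)) (P s)))"
      by (simp add: sum.reindex)
    also have "I - {(m, w)} = {m} \<times> (mu6 - {w}) \<union> ({..<4} - {m}) \<times> mu6"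
      using m by (auto simp: I_def)
    also have "(\<Sum>s\<in>\<dots>. f (inner (P (m, w)) (P s))) =
        (\<Sum>s\<in>{m} \<times> (mu6 - {w}). f (inner (P (m, w)) (P s))) +
        (\<Sum>s\<in>({..<4} - {m}) \<times> mu6. f (inner (P (m, w)) (P s)))"
      by (rule sum.union_disjoint) (auto simp: finite_mu6)
    also have "(\<Sum>s\<in>{m} \<times> (mu6 - {w}). f (inner (P (m, w)) (P s))) =
        (\<Sum>n\<in>{m}. \<Sum>w'\<in>mu6 - {w}. f (inner (P (m, w)) (P (n, w'))))"
      by (subst sum.cartesian_product) simp
    also have "\<dots> = (\<Sum>w'\<in>mu6 - {w}. f (Re (w * cnj w')))"
    proof -
      have "a m * cnj (a m) = 1" by (rule unit_mult_cnj[OF a[OF m]])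
      then show ?thesis by (simp add: P_def inner_hexagon_point axis_product_self[OF m])
    qed
    also have "(\<Sum>s\<in>({..<4} - {m}) \<times> mu6. f (inner (P (m, w)) (P s))) =
        (\<Sum>n\<in>{..<4} - {m}. \<Sum>w'\<in>mu6. f (inner (P (m, w)) (P (n, w'))))"
      by (subst sum.cartesian_product) simp
    also have "\<dots> = R m"
      unfolding R_def
    proof (rule sum.cong[OF refl])
      fix n
      define z where "z = a m * cnj (a n) * axis_product m n"
      have s: "sqrt (1/3) * sqrt 3 = 1" by (simp flip: real_sqrt_mult)
      have "sqrt (1/3) * Re (a m * cnj (a n) * (sqrt 3 * axis_product m n) * v) = Re (z * v)" for v
      proof -
        have "a m * cnj (a n) * (sqrt 3 * axis_product m n) * v = sqrt 3 * (z * v)"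
          by (simp add: z_def mult_ac)
        moreover have "Re (complex_of_real (sqrt 3) * y) = sqrt 3 * Re y" for y by simp
        ultimately show ?thesis using s by (metis mult.assoc mult_1)
      qed
      then have "hexagon_sum f (a m * cnj (a n) * (sqrt 3 * axis_product m n)) =
          (\<Sum>v\<in>mu6. f (Re (z * v)))"
        unfolding hexagon_sum_def by simp
      also have "\<dots> = (\<Sum>w'\<in>mu6. f (Re (z * (w * cnj w'))))"
        by (rule sum_mu6_quotient[OF w, symmetric])
      finally show "(\<Sum>w'\<in>mu6. f (inner (P (m, w)) (P (n, w')))) =
          hexagon_sum f (a m * cnj (a n) * (sqrt 3 * axis_product m n))"
        by (simp add: P_def inner_hexagon_point z_def)
    qed
    finally show ?thesis .
  qed
  have "energy f (D_config (a 0) (a 1) (a 2) (a 3)) =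
      (\<Sum>s\<in>I. \<Sum>c'\<in>P ` I - {P s}. f (inner (P s) c'))"
    unfolding energy_def D_config_eq_image P_def[symmetric] I_def[symmetric]
    by (simp add: sum.reindex[OF inj])
  also have "\<dots> = (\<Sum>m<4. \<Sum>w\<in>mu6. \<Sum>c'\<in>P ` I - {P (m, w)}. f (inner (P (m, w)) c'))"
    unfolding I_def by (simp add: sum.cartesian_product case_prod_beta)
  also have "\<dots> = (\<Sum>m<4. \<Sum>w\<in>mu6. (\<Sum>w'\<in>mu6 - {w}. f (Re (w * cnj w'))) + R m)"
    by (intro sum.cong refl) (simp add: row)
  also have "\<dots> = 4 * (\<Sum>w\<in>mu6. \<Sum>w'\<in>mu6 - {w}. f (Re (w * cnj w'))) + 6 * (\<Sum>m<4. R m)"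
    by (simp add: sum.distrib card_mu6 sum_distrib_left)
  finally show ?thesis by (simp add: R_def)
qed

lemma energy_difference:
  fixes a :: "nat \<Rightarrow> complex"
  assumes a: "\<And>m. m < 4 \<Longrightarrow> cmod (a m) = 1"
  shows "energy f (D_config (a 0) (a 1) (a 2) (a 3)) = energy f C_D4 +
    6 * (\<Sum>m<4. \<Sum>n\<in>{..<4} - {m}.
      hexagon_sum f (a m * cnj (a n) * (sqrt 3 * axis_product m n)) - hexagon_sum f \<i>)"
proof -
  have "hexagon_sum f (sqrt 3 * axis_product m n) = hexagon_sum f \<i>"
    if "m < 4" "n < 4" "m \<noteq> n" for m n
    using sqrt3_axis_product[OF that] hexagon_sum_minus_i by auto
  then have "energy f C_D4 = 4 * (\<Sum>w\<in>mu6. \<Sum>w'\<in>mu6 - {w}. f (Re (w * cnj w'))) +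
      6 * (\<Sum>m<4::nat. \<Sum>n\<in>{..<4::nat} - {m}. hexagon_sum f \<i>)"
    using energy_D_config[of "\<lambda>_. 1" f] by (simp add: C_D4_def)
  moreover note energy_D_config[OF a]
  ultimately show ?thesis by (simp add: sum_subtractf)
qed

text \<open>
  The phases \<open>a m\<close> and \<open>a 0\<close> differ by a sixth root of unity, which permutes the points of a hexagon.
\<close>

lemma D_config_eq_rotation:
  fixes a :: "nat \<Rightarrow> complex"
  assumes a0: "cmod (a 0) = 1" and a: "\<And>m. m < 4 \<Longrightarrow> (a 0 * cnj (a m)) ^ 6 = 1"
  shows "D_config (a 0) (a 1) (a 2) (a 3) = (\<lambda>z. (a 0 * fst z, a 0 * snd z)) ` C_D4"
proof -
  have row: "(\<lambda>w. hexagon_point a (m, w)) ` mu6 = (\<lambda>w. hexagon_point (\<lambda>_. a 0) (m, w)) ` mu6"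
    if m: "m < 4" for m
  proof -
    define v where "v = cnj (a 0) * a m"
    have "cnj v ^ 6 = 1" using a[OF m] by (simp add: v_def)
    then have v: "v \<in> mu6"
      unfolding mu6_def by (metis (mono_tags) complex_cnj_cnj complex_cnj_one complex_cnj_power mem_Collect_eq)
    have "a m = a 0 * v"
      using unit_mult_cnj[OF a0] by (simp add: v_def flip: mult.assoc)
    then have "(\<lambda>w. hexagon_point a (m, w)) ` mu6 = (\<lambda>w. hexagon_point (\<lambda>_. a 0) (m, w)) ` ((*) v ` mu6)"
      by (simp add: hexagon_point_def image_image mult_ac)
    then show ?thesis by (simp only: mult_mu6[OF v])
  qed
  have rows: "hexagon_point b ` ({..<4} \<times> mu6) = (\<Union>m<4. (\<lambda>w. hexagon_point b (m, w)) ` mu6)" for b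
    by auto
  have "D_config (a 0) (a 1) (a 2) (a 3) = hexagon_point (\<lambda>_. a 0) ` ({..<4} \<times> mu6)"
    unfolding D_config_eq_image rows by (intro SUP_cong refl) (simp add: row)
  also have "\<dots> = (\<lambda>z. (a 0 * fst z, a 0 * snd z)) ` hexagon_point (\<lambda>_. 1) ` ({..<4} \<times> mu6)"
    by (simp add: image_image hexagon_point_def case_prod_beta mult_ac)
  finally show ?thesis using D_config_eq_image[of "\<lambda>_. 1"] by (simp add: C_D4_def)
qed

lemma orthogonal_transformation_unit_scaling:
  assumes "cmod c = 1"
  shows "orthogonal_transformation (\<lambda>z::complex \<times> complex. (c * fst z, c * snd z))"
  unfolding orthogonal_transformation_def
proof (intro conjI allI)
  show "linear (\<lambda>z::complex \<times> complex. (c * fst z, c * snd z))"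
    by (rule linearI) (simp_all add: algebra_simps)
  fix v w :: "complex \<times> complex"
  have "c * x * cnj (c * y) = x * cnj y" for x y
  proof -
    have "c * x * cnj (c * y) = (c * cnj c) * (x * cnj y)" by (simp add: mult_ac)
    then show ?thesis by (simp add: unit_mult_cnj[OF assms])
  qed
  then show "inner (c * fst v, c * snd v) (c * fst w, c * snd w) = inner v w"
    by (cases v; cases w) (simp only: inner_C2 fst_conv snd_conv)
qed

section \<open>Optimality of the 24-cell within the family\<close>

theorem mainTheorem4:
  fixes f :: "real \<Rightarrow> real"
  assumes "absolutely_monotonic f"
  shows "(\<forall>a0 a1 a2 a3 :: complex.
            cmod a0 = 1 \<and> cmod a1 = 1 \<and> cmod a2 = 1 \<and> cmod a3 = 1 \<longrightarrow>
            energy f C_D4 \<le> energy f (D_config a0 a1 a2 a3)) \<and>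
         (\<not> poly_degree_le_on {-1..<1} 5 f \<longrightarrow>
          (\<forall>a0 a1 a2 a3 :: complex.
            cmod a0 = 1 \<and> cmod a1 = 1 \<and> cmod a2 = 1 \<and> cmod a3 = 1 \<and>
            energy f C_D4 = energy f (D_config a0 a1 a2 a3) \<longrightarrow>
            (\<exists>T :: complex \<times> complex \<Rightarrow> complex \<times> complex.
               orthogonal_transformation T \<and> D_config a0 a1 a2 a3 = T ` C_D4)))"
proof -
  have main: "energy f C_D4 \<le> energy f (D_config a0 a1 a2 a3) \<and>
      (\<not> poly_degree_le_on {-1..<1} 5 f \<longrightarrow> energy f C_D4 = energy f (D_config a0 a1 a2 a3) \<longrightarrow>
        (\<exists>T :: complex \<times> complex \<Rightarrow> complex \<times> complex.
           orthogonal_transformation T \<and> D_config a0 a1 a2 a3 = T ` C_D4))"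
    if unit: "cmod a0 = 1" "cmod a1 = 1" "cmod a2 = 1" "cmod a3 = 1" for a0 a1 a2 a3
  proof -
    define a where "a m = [a0, a1, a2, a3] ! m" for m
    have D: "D_config a0 a1 a2 a3 = D_config (a 0) (a 1) (a 2) (a 3)"
      by (simp add: a_def)
    have a: "cmod (a m) = 1" if "m < 4" for m
      using less_4_cases[OF that] unit by (auto simp: a_def)
    define z where "z m n = a m * cnj (a n) * (sqrt 3 * axis_product m n)" for m n
    have z: "cmod (z m n) = 1" if "m < 4" "n < 4" "m \<noteq> n" for m n
    proof -
      have "cmod (sqrt 3 * axis_product m n) = 1" using sqrt3_axis_product[OF that] by auto
      then show ?thesis using a that by (simp only: z_def norm_mult[of "a m * cnj (a n)"]) (simp add: norm_mult)
    qed
    \<comment> \<open>the excess of the interaction of hexagons \<open>m\<close> and \<open>n\<close> over its value in the 24-cell\<close>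
    define \<delta> where "\<delta> m n = hexagon_sum f (z m n) - hexagon_sum f \<i>" for m n
    have \<delta>: "\<delta> m n \<ge> 0" if "m < 4" "n < 4" "m \<noteq> n" for m n
      using hexagon_sum_minimum(1)[OF assms z[OF that]] by (simp add: \<delta>_def)
    have diff: "energy f (D_config a0 a1 a2 a3) =
        energy f C_D4 + 6 * (\<Sum>m<4. \<Sum>n\<in>{..<4} - {m}. \<delta> m n)"
      unfolding D \<delta>_def z_def by (rule energy_difference[OF a])
    have rows: "(\<Sum>n\<in>{..<4} - {m}. \<delta> m n) \<ge> 0" if "m < 4" for m
      using that by (intro sum_nonneg \<delta>) auto
    then have "(\<Sum>m<4. \<Sum>n\<in>{..<4} - {m}. \<delta> m n) \<ge> 0"
      by (rule sum_nonneg) simp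
    then have "energy f C_D4 \<le> energy f (D_config a0 a1 a2 a3)" using diff by simp
    moreover have "\<exists>T :: complex \<times> complex \<Rightarrow> complex \<times> complex.
           orthogonal_transformation T \<and> D_config a0 a1 a2 a3 = T ` C_D4"
      if np: "\<not> poly_degree_le_on {-1..<1} 5 f" and eq: "energy f C_D4 = energy f (D_config a0 a1 a2 a3)"
    proof -
      have "(\<Sum>m<4. \<Sum>n\<in>{..<4} - {m}. \<delta> m n) = 0" using diff eq by simp
      then have "(\<Sum>n\<in>{..<4} - {0}. \<delta> 0 n) = 0"
        by (rule sum_nonneg_0[of "{..<4}", rotated 2]) (simp_all add: rows)
      then have \<delta>0: "\<delta> 0 n = 0" if "n < 4" "n \<noteq> 0" for n
        by (rule sum_nonneg_0[of "{..<4} - {0}", rotated 2]) (use \<delta>[of 0] that in auto)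
      have "(a 0 * cnj (a n)) ^ 6 = 1" if n: "n < 4" for n
      proof (cases "n = 0")
        case True
        then show ?thesis using unit_mult_cnj[OF a, of 0] by simp
      next
        case False
        then have "hexagon_sum f \<i> = hexagon_sum f (z 0 n)" using \<delta>0[OF n] by (simp add: \<delta>_def)
        then have "z 0 n ^ 6 = - 1"
          using hexagon_sum_minimum(2)[OF assms z np, of 0 n] n False by simp
        moreover have "(sqrt 3 * axis_product 0 n) ^ 6 = - 1"
          using sqrt3_axis_product[of 0 n] n False by (auto simp: power_numeral_reduce)
        ultimately show ?thesis unfolding z_def power_mult_distrib[of _ "sqrt 3 * axis_product 0 n"] by simp
      qed
      then have "D_config a0 a1 a2 a3 = (\<lambda>z. (a 0 * fst z, a 0 * snd z)) ` C_D4"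
        unfolding D by (intro D_config_eq_rotation a) simp_all
      then show ?thesis using orthogonal_transformation_unit_scaling[OF a, of 0] by auto
    qed
    ultimately show ?thesis by blast
  qed
  show ?thesis using main by blast
qed

end
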